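(* Let $k$ be an algebraically closed field, let $\chi$ be its characteristic, let $m, n \in \mathbb{N}$, and let $(f_1,\ldots,f_m)$ be a sequence of polynomials in $k[t_1,\ldots,t_n]$ that is algebraically independent over $k$. Then: (1) If $\chi = 0$, then $k\langle f_1,\ldots,f_m\rangle \subseteq k(f_1,\ldots,f_m) \cap k[t_1,\ldots,t_n]$. (2) If $\chi > 0$, then $k\langle f_1,\ldots,f_m\rangle \subseteq \mathrm{rad}_\chi\bigl(k(f_1,\ldots,f_m) \cap k[t_1,\ldots,t_n]\bigr)$.
   Context: $\mathbb{N}$ denotes the positive integers and $\mathbb{N}_0 = \mathbb{N}\cup\{0\}$. For $f_1,\ldots,f_m \in k[t_1,\ldots,t_n]$, a polynomial $g \in k[t_1,\ldots,t_n]$ is determined by $(f_1,\ldots,f_m)$ if for all $\mathbf{a},\mathbf{b} \in k^n$ with $f_i(\mathbf{a}) = f_i(\mathbf{b})$ for all $i \in \{1,\ldots,m\}$ we have $g(\mathbf{a}) = g(\mathbf{b})$. $k\langle f_1,\ldots,f_m\rangle$ denotes the set (a $k$-subalgebra) of all polynomials in $k[t_1,\ldots,t_n]$ determined by $(f_1,\ldots,f_m)$. $k(f_1,\ldots,f_m)$ denotes the subfield of the quotient field $k(t_1,\ldots,t_n)$ of $k[t_1,\ldots,t_n]$ generated by $k \cup \{f_1,\ldots,f_m\}$. If $k$ has characteristic $\chi > 0$ and $P \subseteq k[t_1,\ldots,t_n]$, then $\mathrm{rad}_\chi(P) := \{ f \in k[t_1,\ldots,t_n] \mid \text{there is } \nu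 \in \mathbb{N}_0 \text{ with } f^{\chi^\nu} \in P\}$. *)

theory Defs
  imports
    "HOL-Library.Poly_Mapping"
    "HOL-Library.FuncSet"
    "HOL-Computational_Algebra.Polynomial_Factorial"
begin

text \<open>Polynomials with coefficients in \<open>'k\<close> in the variables \<open>t_0, t_1, t_2, \<dots>\<close>: finitely supported
  maps from monomials (finitely supported exponent functions) to coefficients. The variables
  of \<open>k[t_1, \<dots>, t_n]\<close> are represented by the indices \<open>0, \<dots>, n - 1\<close>.\<close>

type_synonym 'k mpoly = "(nat \<Rightarrow>\<^sub>0 nat) \<Rightarrow>\<^sub>0 'k"

definition mpoly_vars :: "'k::zero mpoly \<Rightarrow> nat set" where
  "mpoly_vars p = (\<Union>\<mu>\<in>Poly_Mapping.keys p. Poly_Mapping.keys \<mu>)"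

definition mpoly_ring :: "nat \<Rightarrow> 'k::zero mpoly set" where
  "mpoly_ring n = {p. mpoly_vars p \<subseteq> {..<n}}"

definition mpoly_const :: "'k::zero \<Rightarrow> 'k mpoly" where
  "mpoly_const c = Poly_Mapping.single 0 c"

text \<open>The value of \<open>p\<close> at \<open>x\<close> in a ring that contains the coefficients via \<open>h\<close>.\<close>

definition mpoly_subst :: "('k::zero \<Rightarrow> 'r::comm_semiring_1) \<Rightarrow> 'k mpoly \<Rightarrow> (nat \<Rightarrow> 'r) \<Rightarrow> 'r" where
  "mpoly_subst h p x =
     (\<Sum>\<mu>\<in>Poly_Mapping.keys p.
        h (Poly_Mapping.lookup p \<mu>) * (\<Prod>i\<in>Poly_Mapping.keys \<mu>. x i ^ Poly_Mapping.lookup \<mu> i))"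

definition mpoly_eval :: "'k::comm_semiring_1 mpoly \<Rightarrow> (nat \<Rightarrow> 'k) \<Rightarrow> 'k" where
  "mpoly_eval p a = mpoly_subst (\<lambda>c. c) p a"

text \<open>Only \<open>f 0, \<dots>, f (m - 1)\<close> matter; they represent the sequence \<open>(f_1, \<dots>, f_m)\<close>, here and below.\<close>

definition alg_independent :: "nat \<Rightarrow> (nat \<Rightarrow> 'k::comm_ring_1 mpoly) \<Rightarrow> bool" where
  "alg_independent m f \<longleftrightarrow> (\<forall>p\<in>mpoly_ring m. mpoly_subst mpoly_const p f = 0 \<longrightarrow> p = 0)"

text \<open>Points of \<open>k^n\<close> are extensional functions on \<open>{..<n}\<close>.\<close>

definition determined_by :: "nat \<Rightarrow> nat \<Rightarrow> (nat \<Rightarrow> 'k::comm_ring_1 mpoly) \<Rightarrow> 'k mpoly \<Rightarrow> bool" where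
  "determined_by n m f g \<longleftrightarrow>
     (\<forall>a \<in> {..<n} \<rightarrow>\<^sub>E UNIV. \<forall>b \<in> {..<n} \<rightarrow>\<^sub>E UNIV.
        (\<forall>i<m. mpoly_eval (f i) a = mpoly_eval (f i) b) \<longrightarrow> mpoly_eval g a = mpoly_eval g b)"

definition determined_algebra :: "nat \<Rightarrow> nat \<Rightarrow> (nat \<Rightarrow> 'k::comm_ring_1 mpoly) \<Rightarrow> 'k mpoly set" where
  "determined_algebra n m f = {g \<in> mpoly_ring n. determined_by n m f g}"

definition is_subfield :: "'a::field set \<Rightarrow> bool" where
  "is_subfield F \<longleftrightarrow> 0 \<in> F \<and> 1 \<in> F \<and>
     (\<forall>x\<in>F. \<forall>y\<in>F. x + y \<in> F \<and> x * y \<in> F) \<and> (\<forall>x\<in>F. - x \<in> F \<and> inverse x \<in> F)"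

text \<open>\<open>k(t_1, \<dots>, t_n)\<close>, inside the quotient field of the ring of polynomials in all variables.\<close>

definition rat_funs :: "nat \<Rightarrow> 'k::field mpoly fract set" where
  "rat_funs n = {Fract p q | p q. p \<in> mpoly_ring n \<and> q \<in> mpoly_ring n \<and> q \<noteq> 0}"

text \<open>\<open>k(f_1, \<dots>, f_m)\<close>: the least subfield of \<open>k(t_1, \<dots>, t_n)\<close> containing the generators. The
  hull is an intersection; it is a subfield by \<open>is_subfield_rat_gen\<close> below.\<close>

definition rat_gen :: "nat \<Rightarrow> nat \<Rightarrow> (nat \<Rightarrow> 'k::field mpoly) \<Rightarrow> 'k mpoly fract set" where
  "rat_gen n m f = (\<lambda>F. is_subfield F \<and> F \<subseteq> rat_funs n) hull
     (to_fract ` (range mpoly_const \<union> f ` {..<m}))"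

text \<open>\<open>k(f_1, \<dots>, f_m) \<inter> k[t_1, \<dots>, t_n]\<close>, as a set of polynomials.\<close>

definition rat_gen_polys :: "nat \<Rightarrow> nat \<Rightarrow> (nat \<Rightarrow> 'k::field mpoly) \<Rightarrow> 'k mpoly set" where
  "rat_gen_polys n m f = {p \<in> mpoly_ring n. to_fract p \<in> rat_gen n m f}"

definition rad_char :: "nat \<Rightarrow> 'k::field mpoly set \<Rightarrow> 'k mpoly set" where
  "rad_char n P = {f \<in> mpoly_ring n. \<exists>\<nu>::nat. f ^ (CHAR('k) ^ \<nu>) \<in> P}"

lemma mpoly_const_in_mpoly_ring: "mpoly_const c \<in> mpoly_ring n"
  by (auto simp: mpoly_const_def mpoly_ring_def mpoly_vars_def)

lemma mpoly_ring_closed: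
  fixes p q :: "'k::comm_ring_1 mpoly"
  shows "0 \<in> mpoly_ring n" "1 \<in> mpoly_ring n"
    and "p \<in> mpoly_ring n \<Longrightarrow> - p \<in> mpoly_ring n"
    and "p \<in> mpoly_ring n \<Longrightarrow> q \<in> mpoly_ring n \<Longrightarrow> p + q \<in> mpoly_ring n"
    and "p \<in> mpoly_ring n \<Longrightarrow> q \<in> mpoly_ring n \<Longrightarrow> p * q \<in> mpoly_ring n"
proof -
  show "0 \<in> mpoly_ring n" "1 \<in> mpoly_ring n"
    by (auto simp: mpoly_ring_def mpoly_vars_def)
  show "p \<in> mpoly_ring n \<Longrightarrow> - p \<in> mpoly_ring n"
    by (auto simp: mpoly_ring_def mpoly_vars_def)
  show "p \<in> mpoly_ring n \<Longrightarrow> q \<in> mpoly_ring n \<Longrightarrow> p + q \<in> mpoly_ring n"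
    using Poly_Mapping.keys_add[of p q] unfolding mpoly_ring_def mpoly_vars_def by blast
  assume p: "p \<in> mpoly_ring n" and q: "q \<in> mpoly_ring n"
  have "Poly_Mapping.keys \<mu> \<subseteq> {..<n}" if "\<mu> \<in> Poly_Mapping.keys (p * q)" for \<mu>
  proof -
    obtain a b where "\<mu> = a + b" "a \<in> Poly_Mapping.keys p" "b \<in> Poly_Mapping.keys q"
      using keys_mult[of p q] \<open>\<mu> \<in> Poly_Mapping.keys (p * q)\<close> by blast
    with p q show ?thesis
      using Poly_Mapping.keys_add[of a b] unfolding mpoly_ring_def mpoly_vars_def by blast
  qed
  then show "p * q \<in> mpoly_ring n"
    by (auto simp: mpoly_ring_def mpoly_vars_def)
qed

lemma is_subfield_rat_funs: "is_subfield (rat_funs n :: 'k::field mpoly fract set)"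
proof -
  note c = mpoly_ring_closed
  have frac: "Fract p q \<in> rat_funs n"
    if "p \<in> mpoly_ring n" "q \<in> mpoly_ring n" "q \<noteq> 0" for p q :: "'k mpoly"
    using that by (auto simp: rat_funs_def)
  have zo: "(0 :: 'k mpoly fract) \<in> rat_funs n" "(1 :: 'k mpoly fract) \<in> rat_funs n"
    unfolding Zero_fract_def One_fract_def by (rule frac; simp add: c)+
  have "x + y \<in> rat_funs n \<and> x * y \<in> rat_funs n"
    if "x \<in> rat_funs n" "y \<in> rat_funs n" for x y :: "'k mpoly fract"
  proof -
    obtain p q where "x = Fract p q" "p \<in> mpoly_ring n" "q \<in> mpoly_ring n" "q \<noteq> 0"
      using \<open>x \<in> rat_funs n\<close> by (auto simp: rat_funs_def)
    moreover obtain r s where "y = Fract r s" "r \<in> mpoly_ring n" "s \<in> mpoly_ring n" "s \<noteq> 0"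
      using \<open>y \<in> rat_funs n\<close> by (auto simp: rat_funs_def)
    ultimately show ?thesis
      by (simp add: frac c)
  qed
  moreover have "- x \<in> rat_funs n \<and> inverse x \<in> rat_funs n"
    if "x \<in> rat_funs n" for x :: "'k mpoly fract"
  proof -
    obtain p q where pq: "x = Fract p q" "p \<in> mpoly_ring n" "q \<in> mpoly_ring n" "q \<noteq> 0"
      using \<open>x \<in> rat_funs n\<close> by (auto simp: rat_funs_def)
    show ?thesis
      using pq zo by (cases "p = 0") (simp_all add: frac c fract_collapse)
  qed
  ultimately show ?thesis
    using zo by (simp add: is_subfield_def)
qed

lemma is_subfield_rat_gen:
  assumes "\<forall>i<m. f i \<in> mpoly_ring n"
  shows "is_subfield (rat_gen n m f)" "rat_gen n m f \<subseteq> rat_funs n"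
proof -
  have "to_fract p \<in> rat_funs n" if "p \<in> mpoly_ring n" for p :: "'a mpoly"
    unfolding to_fract_def rat_funs_def
    using that mpoly_ring_closed(2) zero_neq_one[where 'a = "'a mpoly"] by force
  then have "to_fract ` (range mpoly_const \<union> f ` {..<m}) \<subseteq> rat_funs n"
    using assms mpoly_const_in_mpoly_ring by blast
  then show "rat_gen n m f \<subseteq> rat_funs n"
    unfolding rat_gen_def hull_def using is_subfield_rat_funs by blast
  show "is_subfield (rat_gen n m f)"
    unfolding rat_gen_def hull_def is_subfield_def by blast
qed

end

theory Submission
  imports Defs
begin

text \<open>Let \<open>A = k[f\<^sub>1, \<dots>, f\<^sub>m]\<close>, let \<open>g\<close> be determined by \<open>f\<close>, and suppose that no power \<open>h = g\<^bsup>N\<^esup>\<close>,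
  with \<open>N = \<chi>\<^bsup>\<nu>\<^esup>\<close>, lies in \<open>k(f\<^sub>1, \<dots>, f\<^sub>m)\<close>. For a suitable \<open>\<nu>\<close>, either \<open>h\<close> is transcendental over \<open>A\<close> or
  it is a root of a polynomial of minimal degree over \<open>A\<close> that has degree at least 2 and nonzero
  derivative. Homomorphisms to an algebraically closed field extend from a domain to a finitely
  generated extension domain as long as a certain nonzero element of the smaller one is not
  annihilated (the Nullstellensatz in its generic form). Hence a generic homomorphism \<open>A \<rightarrow> k\<close> has two
  extensions to \<open>A[h]\<close> with distinct values at \<open>h\<close>, and both extend further to
  \<open>k[t\<^sub>1, \<dots>, t\<^sub>n]\<close>. These are evaluations at two points where \<open>f\<close> agrees and \<open>g\<close> does not.\<close>

section \<open>Subrings of a domain and the adjunction of one element\<close>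

definition subring :: "'r::idom set \<Rightarrow> bool" where
  "subring A \<longleftrightarrow> 1 \<in> A \<and> (\<forall>x\<in>A. \<forall>y\<in>A. x - y \<in> A \<and> x * y \<in> A)"

definition polys_over :: "'r::idom set \<Rightarrow> 'r poly set" where
  "polys_over A = {p. \<forall>i. coeff p i \<in> A}"

definition adjoin :: "'r::idom set \<Rightarrow> 'r \<Rightarrow> 'r set" where
  "adjoin A x = (\<lambda>p. poly p x) ` polys_over A"

text \<open>Homomorphisms on \<open>A\<close> are total functions whose values outside
  \<open>A\<close> are arbitrary, so that extending one to a larger ring only means agreement on
  \<open>A\<close>.\<close>

definition hom_on :: "'r::idom set \<Rightarrow> ('r \<Rightarrow> 'k::idom) \<Rightarrow> bool" where
  "hom_on A \<phi> \<longleftrightarrow> \<phi> 1 = 1 \<and>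
     (\<forall>x\<in>A. \<forall>y\<in>A. \<phi> (x + y) = \<phi> x + \<phi> y \<and> \<phi> (x * y) = \<phi> x * \<phi> y)"

definition hom_ext :: "'r::idom set \<Rightarrow> ('r \<Rightarrow> 'k::idom) \<Rightarrow> 'r set \<Rightarrow> ('r \<Rightarrow> 'k) \<Rightarrow> bool" where
  "hom_ext A \<phi> B \<psi> \<longleftrightarrow> hom_on B \<psi> \<and> (\<forall>a\<in>A. \<psi> a = \<phi> a)"

text \<open>The coefficients stay in \<open>A\<close> instead of its quotient field, so
  \<open>P\<close> need not be monic. Clearing denominators shows that its degree is still the one
  over the quotient field.\<close>

definition minimal_poly :: "'r::idom set \<Rightarrow> 'r \<Rightarrow> 'r poly \<Rightarrow> bool" where
  "minimal_poly A x P \<longleftrightarrow> P \<in> polys_over A \<and> P \<noteq> 0 \<and> poly P x = 0 \<and>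
     (\<forall>Q\<in>polys_over A. Q \<noteq> 0 \<longrightarrow> poly Q x = 0 \<longrightarrow> degree P \<le> degree Q)"

context
  fixes A :: "'r::idom set"
  assumes A: "subring A"
begin

lemma subring_one: "1 \<in> A"
  and subring_diff: "x \<in> A \<Longrightarrow> y \<in> A \<Longrightarrow> x - y \<in> A"
  and subring_mult: "x \<in> A \<Longrightarrow> y \<in> A \<Longrightarrow> x * y \<in> A"
  using A by (auto simp: subring_def)

lemma subring_zero: "0 \<in> A"
  using subring_diff[OF subring_one subring_one] by simp

lemma subring_uminus: "x \<in> A \<Longrightarrow> - x \<in> A"
  using subring_diff[OF subring_zero] by simp

lemma subring_add: "x \<in> A \<Longrightarrow> y \<in> A \<Longrightarrow> x + y \<in> A"
  using subring_diff[OF _ subring_uminus] by simp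

lemma subring_sum: "(\<And>i. i \<in> I \<Longrightarrow> f i \<in> A) \<Longrightarrow> sum f I \<in> A"
  by (induction I rule: infinite_finite_induct) (auto intro: subring_zero subring_add)

lemma subring_prod: "(\<And>i. i \<in> I \<Longrightarrow> f i \<in> A) \<Longrightarrow> prod f I \<in> A"
  by (induction I rule: infinite_finite_induct) (auto intro: subring_one subring_mult)

lemma subring_power: "x \<in> A \<Longrightarrow> x ^ n \<in> A"
  by (induction n) (auto intro: subring_one subring_mult)

lemma subring_of_nat: "of_nat n \<in> A"
  by (induction n) (auto intro: subring_zero subring_one subring_add)

lemma polys_over_add: "p \<in> polys_over A \<Longrightarrow> q \<in> polys_over A \<Longrightarrow> p + q \<in> polys_over A"
  and polys_over_diff: "p \<in> polys_over A \<Longrightarrow> q \<in> polys_over A \<Longrightarrow> p - q \<in> polys_over A"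
  and polys_over_smult: "c \<in> A \<Longrightarrow> p \<in> polys_over A \<Longrightarrow> smult c p \<in> polys_over A"
  and polys_over_mult: "p \<in> polys_over A \<Longrightarrow> q \<in> polys_over A \<Longrightarrow> p * q \<in> polys_over A"
  and polys_over_monom: "c \<in> A \<Longrightarrow> monom c n \<in> polys_over A"
  and polys_over_zero: "0 \<in> polys_over A"
  and polys_over_pCons: "c \<in> A \<Longrightarrow> p \<in> polys_over A \<Longrightarrow> pCons c p \<in> polys_over A"
  and polys_over_pderiv: "p \<in> polys_over A \<Longrightarrow> pderiv p \<in> polys_over A"
  unfolding polys_over_def
  by (auto simp: coeff_mult coeff_pderiv coeff_pCons subring_zero subring_of_nat split: nat.split
    intro!: subring_add subring_diff subring_mult subring_sum
    simp del: of_nat_Suc)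

lemma subset_adjoin: "A \<subseteq> adjoin A x"
proof
  fix a assume "a \<in> A"
  then have "[:a:] \<in> polys_over A"
    by (simp add: polys_over_pCons polys_over_zero)
  then show "a \<in> adjoin A x"
    unfolding adjoin_def by (rule rev_image_eqI) simp
qed

lemma generator_in_adjoin: "x \<in> adjoin A x"
proof -
  have "[:0, 1:] \<in> polys_over A"
    by (simp add: polys_over_pCons polys_over_zero subring_zero subring_one)
  then show ?thesis
    unfolding adjoin_def by (rule rev_image_eqI) simp
qed

lemma subring_adjoin: "subring (adjoin A x)"
  unfolding subring_def
proof (intro conjI ballI)
  show "1 \<in> adjoin A x"
    using subset_adjoin subring_one by blast
  fix y z assume "y \<in> adjoin A x" "z \<in> adjoin A x"
  then obtain p q where *: "p \<in> polys_over A" "q \<in> polys_over A" "y = poly p x" "z = poly q x"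
    by (auto simp: adjoin_def)
  show "y - z \<in> adjoin A x"
    unfolding adjoin_def by (rule image_eqI[of _ _ "p - q"]) (simp_all add: * polys_over_diff)
  show "y * z \<in> adjoin A x"
    unfolding adjoin_def by (rule image_eqI[of _ _ "p * q"]) (simp_all add: * polys_over_mult)
qed

section \<open>Pseudo-division and minimal polynomials\<close>

text \<open>Division with remainder without inverting the leading coefficient of \<open>P\<close>:
  each step multiplies \<open>q\<close> by it and then cancels the leading term of the result
  against a multiple of \<open>P\<close>.\<close>

lemma pseudo_division:
  assumes P: "P \<in> polys_over A" "P \<noteq> 0" and q: "q \<in> polys_over A"
  shows "\<exists>e. \<exists>s\<in>polys_over A. \<exists>r\<in>polys_over A.
           smult (lead_coeff P ^ e) q = s * P + r \<and> (r = 0 \<or> degree r < degree P)"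
  using q
\<comment> \<open>The measure puts the zero polynomial strictly below the nonzero constants, which
  also have degree 0. This matters when \<open>P\<close> is constant.\<close>
proof (induction "if q = 0 then 0 else Suc (degree q)" arbitrary: q rule: less_induct)
  case less
  show ?case
  proof (cases "q = 0 \<or> degree q < degree P")
    case True
    then show ?thesis
      using less.prems polys_over_zero by (intro exI[of _ 0] bexI[of _ 0] bexI[of _ q]) auto
  next
    case False
    define t where "t = monom (lead_coeff q) (degree q - degree P)"
    define q' where "q' = smult (lead_coeff P) q - t * P"
    have lc: "lead_coeff P \<in> A" "lead_coeff q \<in> A"
      using P less.prems by (auto simp: polys_over_def)
    have t: "t \<in> polys_over A"
      unfolding t_def using lc by (intro polys_over_monom)
    have q': "q' \<in> polys_over A"
      unfolding q'_def using t P less.prems lc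
      by (intro polys_over_diff polys_over_mult polys_over_smult)
    have "degree (t * P) \<le> degree q"
      using degree_mult_le[of t P] degree_monom_le[of "lead_coeff q" "degree q - degree P"] False
      unfolding t_def by linarith
    then have "degree q' \<le> degree q"
      unfolding q'_def by (intro degree_diff_le) (auto intro: order_trans[OF degree_smult_le])
    moreover have "coeff q' (degree q) = 0"
      using False by (simp add: q'_def t_def coeff_monom_mult)
    ultimately have "q' = 0 \<or> degree q' < degree q"
      by (rule eq_zero_or_degree_less)
    then obtain e s r where *: "s \<in> polys_over A" "r \<in> polys_over A"
      "smult (lead_coeff P ^ e) q' = s * P + r" "r = 0 \<or> degree r < degree P"
      using less.hyps[OF _ q'] False by (cases "q' = 0") auto
    have "smult (lead_coeff P ^ Suc e) q = (s + smult (lead_coeff P ^ e) t) * P + r"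
      using *(3) by (simp add: q'_def smult_diff_right algebra_simps)
    moreover have "s + smult (lead_coeff P ^ e) t \<in> polys_over A"
      using * t lc by (intro polys_over_add polys_over_smult subring_power)
    ultimately show ?thesis
      using * by blast
  qed
qed

lemma minimal_poly_exists:
  assumes "Q \<in> polys_over A" "Q \<noteq> 0" "poly Q x = 0"
  shows "\<exists>P. minimal_poly A x P"
proof -
  have "\<exists>P. is_arg_min degree (\<lambda>Q. Q \<in> polys_over A \<and> Q \<noteq> 0 \<and> poly Q x = 0) P"
    using assms ex_has_least_nat[of "\<lambda>Q. Q \<in> polys_over A \<and> Q \<noteq> 0 \<and> poly Q x = 0" Q degree]
    by (auto simp: is_arg_min_linorder)
  then show ?thesis
    by (auto simp: is_arg_min_linorder minimal_poly_def)
qed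

lemma minimal_poly_less:
  assumes "minimal_poly A x P" "Q \<in> polys_over A" "poly Q x = 0" "Q = 0 \<or> degree Q < degree P"
  shows "Q = 0"
  using assms unfolding minimal_poly_def by (meson not_le)

lemma minimal_poly_degree_pos:
  assumes "minimal_poly A x P"
  shows "degree P > 0"
proof (rule ccontr)
  assume "\<not> degree P > 0"
  then obtain c where "P = [:c:]"
    by (auto elim: degree_eq_zeroE)
  then show False
    using assms by (auto simp: minimal_poly_def)
qed

text \<open>The pseudo-remainder of \<open>q\<close> by \<open>P\<close> vanishes at
  \<open>x\<close>, hence is zero by minimality. The relations satisfied by \<open>x\<close> are
  thus controlled by \<open>P\<close> alone, up to powers of its leading coefficient.\<close>

lemma minimal_poly_pseudo_dvd:
  assumes P: "minimal_poly A x P" and q: "q \<in> polys_over A" "poly q x = 0"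
  obtains e s where "s \<in> polys_over A" "smult (lead_coeff P ^ e) q = s * P"
proof -
  have P': "P \<in> polys_over A" "P \<noteq> 0" "poly P x = 0"
    using P by (auto simp: minimal_poly_def)
  obtain e s r where *: "s \<in> polys_over A" "r \<in> polys_over A"
      "smult (lead_coeff P ^ e) q = s * P + r" "r = 0 \<or> degree r < degree P"
    using pseudo_division[OF P'(1,2) q(1)] by blast
  have "poly r x = 0"
    using arg_cong[OF *(3), of "\<lambda>p. poly p x"] q P' by simp
  then have "r = 0"
    using minimal_poly_less[OF P *(2)] *(4) by blast
  then show ?thesis
    using that * by simp
qed

end

lemma adjoin_subset:
  assumes B: "subring B" and "A \<subseteq> B" "x \<in> B"
  shows "adjoin A x \<subseteq> B"
proof -
  have "poly p x \<in> B" if "p \<in> polys_over A" for p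
    unfolding poly_altdef using that assms
    by (intro subring_sum[OF B] subring_mult[OF B] subring_power[OF B]) (auto simp: polys_over_def)
  then show ?thesis by (auto simp: adjoin_def)
qed

text \<open>Consider the nonzero multiples of \<open>b\<close> that are values at \<open>x\<close>
  of polynomials of degree below \<open>degree P\<close>. A polynomial \<open>D\<close> of least
  degree among these must be constant, since otherwise pseudo-dividing \<open>P\<close> by
  \<open>D\<close> contradicts the choice of \<open>D\<close> or of \<open>P\<close>. The lemma
  moves a condition of nonvanishing from \<open>adjoin A x\<close> down to \<open>A\<close>.\<close>

lemma adjoin_algebraic_multiple:
  assumes A: "subring A" and P: "minimal_poly A x P" and b: "b \<in> adjoin A x" "b \<noteq> 0"
  shows "\<exists>c\<in>A. \<exists>b'\<in>adjoin A x. c \<noteq> 0 \<and> c = b * b'"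
proof -
  have P': "P \<in> polys_over A" "P \<noteq> 0" "poly P x = 0"
    using P by (auto simp: minimal_poly_def)
  have lcP: "lead_coeff P \<in> A"
    using P' by (auto simp: polys_over_def)
  define S where "S = {r \<in> polys_over A. degree r < degree P \<and> poly r x \<noteq> 0 \<and>
    (\<exists>b'\<in>adjoin A x. poly r x = b * b')}"
  note B = subring_adjoin[OF A, of x]
  obtain q where q: "q \<in> polys_over A" "b = poly q x"
    using b by (auto simp: adjoin_def)
  obtain e s r where r: "r \<in> polys_over A"
      "smult (lead_coeff P ^ e) q = s * P + r" "r = 0 \<or> degree r < degree P"
    using pseudo_division[OF A P'(1,2) q(1)] by blast
  have rx: "poly r x = b * lead_coeff P ^ e"
    using arg_cong[OF r(2), of "\<lambda>p. poly p x"] q P' by (simp add: mult.commute)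
  \<comment> \<open>The remainder of \<open>q\<close> modulo \<open>P\<close> takes the value
    \<open>b * lead_coeff P ^ e\<close> at \<open>x\<close>, so it witnesses that \<open>S\<close>
    is not empty.\<close>
  have "r \<in> S"
    unfolding S_def using r rx b P' minimal_poly_degree_pos[OF A P] lcP subring_power[OF A] subset_adjoin[OF A]
    by fastforce
  then obtain D where D: "D \<in> S" and Dmin: "\<And>r. r \<in> S \<Longrightarrow> degree D \<le> degree r"
    using ex_has_least_nat[of "\<lambda>r. r \<in> S" r degree] by blast
  have D': "D \<in> polys_over A" "D \<noteq> 0" "degree D < degree P" "poly D x \<noteq> 0"
    using D by (auto simp: S_def)
  obtain b' where b': "b' \<in> adjoin A x" "poly D x = b * b'"
    using D by (auto simp: S_def)
  have "degree D = 0"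
  proof (rule ccontr)
    assume deg: "degree D \<noteq> 0"
    obtain e s r where *: "s \<in> polys_over A" "r \<in> polys_over A"
        "smult (lead_coeff D ^ e) P = s * D + r" "r = 0 \<or> degree r < degree D"
      using pseudo_division[OF A D'(1,2) P'(1)] by blast
    have rx: "poly r x = - (poly s x * poly D x)"
      using arg_cong[OF *(3), of "\<lambda>p. poly p x"] P'
      by (simp add: eq_neg_iff_add_eq_0 add.commute)
    have "poly s x \<in> adjoin A x"
      using *(1) by (auto simp: adjoin_def)
    then have "\<exists>b'\<in>adjoin A x. poly r x = b * b'"
      using rx b' subring_mult[OF B, of "poly s x" b'] subring_uminus[OF B]
      by (intro bexI[of _ "- (poly s x * b')"]) (auto simp: algebra_simps)
    \<comment> \<open>Otherwise \<open>r\<close> would belong to \<open>S\<close> and have smaller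
      degree than \<open>D\<close>.\<close>
    then have "poly r x = 0"
      using *(2,4) D' Dmin[of r] unfolding S_def by fastforce
    then have sx: "poly s x = 0"
      using rx D' by simp
    \<comment> \<open>What remains is to see that \<open>s\<close> is nonzero and of smaller degree
      than \<open>P\<close>; as \<open>x\<close> is a root of \<open>s\<close>, this contradicts the
      minimality of \<open>P\<close>.\<close>
    have "s \<noteq> 0"
    proof
      assume "s = 0"
      then have "smult (lead_coeff D ^ e) P = r"
        using * by simp
      moreover have "degree (smult (lead_coeff D ^ e) P) = degree P" "smult (lead_coeff D ^ e) P \<noteq> 0"
        using D' P' by auto
      ultimately show False
        using *(4) D' by auto
    qed
    moreover have "degree s < degree P"
    proof -
      have "s * D = smult (lead_coeff D ^ e) P - r"
        using * by simp
      moreover have "degree (smult (lead_coeff D ^ e) P - r) \<le> degree P"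
        using *(4) D' by (intro degree_diff_le) auto
      moreover have "degree (s * D) = degree s + degree D"
        using \<open>s \<noteq> 0\<close> D' by (simp add: degree_mult_eq)
      ultimately show ?thesis
        using deg by simp
    qed
    ultimately show False
      using minimal_poly_less[OF A P *(1) sx] by blast
  qed
  then obtain c where "D = [:c:]"
    by (auto elim: degree_eq_zeroE)
  then have "c \<in> A" "c \<noteq> 0" "c = b * b'"
    using D' b' by (auto simp: polys_over_def dest: spec[of _ 0])
  then show ?thesis
    using b' by blast
qed

section \<open>Homomorphisms on a subring and their action on polynomials\<close>

context
  fixes A :: "'r::idom set" and \<phi> :: "'r \<Rightarrow> 'k::idom"
  assumes A: "subring A" and hom: "hom_on A \<phi>"
begin

lemma hom_zero: "\<phi> 0 = 0"
proof -
  have "\<phi> (0 + 0) = \<phi> 0 + \<phi> 0"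
    using hom subring_zero[OF A] unfolding hom_on_def by blast
  then have "\<phi> 0 + 0 = \<phi> 0 + \<phi> 0" by simp
  then show ?thesis unfolding add_left_cancel by (rule sym)
qed

lemma hom_one: "\<phi> 1 = 1"
  and hom_add: "x \<in> A \<Longrightarrow> y \<in> A \<Longrightarrow> \<phi> (x + y) = \<phi> x + \<phi> y"
  and hom_mult: "x \<in> A \<Longrightarrow> y \<in> A \<Longrightarrow> \<phi> (x * y) = \<phi> x * \<phi> y"
  using hom by (auto simp: hom_on_def)

lemma hom_diff: "x \<in> A \<Longrightarrow> y \<in> A \<Longrightarrow> \<phi> (x - y) = \<phi> x - \<phi> y"
  using hom_add[of "x - y" y] subring_diff[OF A] by simp

lemma hom_sum: "(\<And>i. i \<in> I \<Longrightarrow> f i \<in> A) \<Longrightarrow> \<phi> (sum f I) = (\<Sum>i\<in>I. \<phi> (f i))"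
  by (induction I rule: infinite_finite_induct) (auto simp: hom_zero hom_add subring_sum[OF A])

lemma hom_prod: "(\<And>i. i \<in> I \<Longrightarrow> f i \<in> A) \<Longrightarrow> \<phi> (prod f I) = (\<Prod>i\<in>I. \<phi> (f i))"
  by (induction I rule: infinite_finite_induct) (auto simp: hom_one hom_mult subring_prod[OF A])

lemma hom_power: "x \<in> A \<Longrightarrow> \<phi> (x ^ n) = \<phi> x ^ n"
  by (induction n) (auto simp: hom_one hom_mult subring_power[OF A])

lemma hom_of_nat: "\<phi> (of_nat n) = of_nat n"
  by (induction n) (auto simp: hom_zero hom_one hom_add subring_one[OF A] subring_of_nat[OF A])

lemma coeff_map_hom: "coeff (map_poly \<phi> p) i = \<phi> (coeff p i)"
  by (simp add: coeff_map_poly hom_zero)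

lemma map_poly_hom_add:
    "p \<in> polys_over A \<Longrightarrow> q \<in> polys_over A \<Longrightarrow> map_poly \<phi> (p + q) = map_poly \<phi> p + map_poly \<phi> q"
  and map_poly_hom_diff:
    "p \<in> polys_over A \<Longrightarrow> q \<in> polys_over A \<Longrightarrow> map_poly \<phi> (p - q) = map_poly \<phi> p - map_poly \<phi> q"
  and map_poly_hom_smult:
    "c \<in> A \<Longrightarrow> p \<in> polys_over A \<Longrightarrow> map_poly \<phi> (smult c p) = smult (\<phi> c) (map_poly \<phi> p)"
  and map_poly_hom_mult:
    "p \<in> polys_over A \<Longrightarrow> q \<in> polys_over A \<Longrightarrow> map_poly \<phi> (p * q) = map_poly \<phi> p * map_poly \<phi> q"
  and map_poly_hom_pderiv:
    "p \<in> polys_over A \<Longrightarrow> map_poly \<phi> (pderiv p) = pderiv (map_poly \<phi> p)"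
  by (auto simp: poly_eq_iff coeff_map_hom hom_add hom_diff hom_mult coeff_mult coeff_pderiv
    hom_sum hom_of_nat subring_mult[OF A] subring_of_nat[OF A] polys_over_def
    simp del: of_nat_Suc)

text \<open>Sending \<open>x\<close> to \<open>\<xi>\<close> prescribes the value at
  \<open>poly p x\<close>. Two choices of \<open>p\<close> differ by a polynomial with root
  \<open>x\<close>, so \<open>kernel\<close> makes the value independent of the choice made by
  \<open>SOME\<close>.\<close>

lemma hom_adjoin:
  assumes kernel: "\<And>p. p \<in> polys_over A \<Longrightarrow> poly p x = 0 \<Longrightarrow> poly (map_poly \<phi> p) \<xi> = 0"
  obtains \<psi> where "hom_ext A \<phi> (adjoin A x) \<psi>"
    "\<And>p. p \<in> polys_over A \<Longrightarrow> \<psi> (poly p x) = poly (map_poly \<phi> p) \<xi>"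
proof -
  define \<psi> where "\<psi> y = poly (map_poly \<phi> (SOME p. p \<in> polys_over A \<and> y = poly p x)) \<xi>" for y
  have \<psi>: "\<psi> (poly p x) = poly (map_poly \<phi> p) \<xi>" if p: "p \<in> polys_over A" for p
  proof -
    define q where "q = (SOME q. q \<in> polys_over A \<and> poly p x = poly q x)"
    have q: "q \<in> polys_over A \<and> poly p x = poly q x"
      unfolding q_def by (rule someI[of _ p]) (simp add: p)
    then have "poly (map_poly \<phi> (q - p)) \<xi> = 0"
      using p by (intro kernel polys_over_diff[OF A]) auto
    then show ?thesis
      using p q unfolding \<psi>_def q_def[symmetric] by (simp add: map_poly_hom_diff)
  qed
  have const: "\<psi> a = \<phi> a" if "a \<in> A" for a
    using \<psi>[of "[:a:]"] that
    by (simp add: polys_over_pCons[OF A] polys_over_zero[OF A] map_poly_pCons hom_zero)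
  have "hom_on (adjoin A x) \<psi>"
    unfolding hom_on_def
  proof (intro conjI ballI)
    show "\<psi> 1 = 1"
      using const subring_one[OF A] hom_one by simp
    fix y z assume "y \<in> adjoin A x" "z \<in> adjoin A x"
    then obtain p q where *: "p \<in> polys_over A" "q \<in> polys_over A" "y = poly p x" "z = poly q x"
      by (auto simp: adjoin_def)
    show "\<psi> (y + z) = \<psi> y + \<psi> z"
      using \<psi>[OF polys_over_add[OF A *(1,2)]] * by (simp add: \<psi> map_poly_hom_add)
    show "\<psi> (y * z) = \<psi> y * \<psi> z"
      using \<psi>[OF polys_over_mult[OF A *(1,2)]] * by (simp add: \<psi> map_poly_hom_mult)
  qed
  then show ?thesis
    using that \<psi> const by (auto simp: hom_ext_def)
qed

end


section \<open>Extending homomorphisms to a simple extension\<close>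

text \<open>Without relations every \<open>\<xi>\<close> may be the image of \<open>x\<close>. With
  \<open>b = poly q x\<close>, only the roots of the image of \<open>q\<close> must be avoided; they
  are finitely many as soon as the leading coefficient of \<open>q\<close> survives.\<close>

lemma transcendental_hom_ext:
  fixes A :: "'r::idom set"
  assumes A: "subring A" and transc: "\<And>p. p \<in> polys_over A \<Longrightarrow> poly p x = 0 \<Longrightarrow> p = 0"
    and b: "b \<in> adjoin A x" "b \<noteq> 0"
  shows "\<exists>a\<in>A. a \<noteq> 0 \<and> (\<forall>\<phi> :: 'r \<Rightarrow> 'k::idom. hom_on A \<phi> \<longrightarrow> \<phi> a \<noteq> 0 \<longrightarrow>
    (\<exists>S. finite S \<and> (\<forall>\<xi>. \<xi> \<notin> S \<longrightarrow>
      (\<exists>\<psi>. hom_ext A \<phi> (adjoin A x) \<psi> \<and> \<psi> x = \<xi> \<and> \<psi> b \<noteq> 0))))"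
proof -
  obtain q where q: "q \<in> polys_over A" "b = poly q x"
    using b by (auto simp: adjoin_def)
  have "q \<noteq> 0"
    using q b by auto
  have X: "[:0, 1:] \<in> polys_over A"
    by (simp add: polys_over_pCons[OF A] polys_over_zero[OF A] subring_zero[OF A] subring_one[OF A])
  show ?thesis
  proof (intro bexI[of _ "lead_coeff q"] conjI allI impI)
    show "lead_coeff q \<in> A"
      using q by (auto simp: polys_over_def)
    show "lead_coeff q \<noteq> 0"
      using \<open>q \<noteq> 0\<close> by simp
    fix \<phi> :: "'r \<Rightarrow> 'k" assume \<phi>: "hom_on A \<phi>" "\<phi> (lead_coeff q) \<noteq> 0"
    have "coeff (map_poly \<phi> q) (degree q) \<noteq> 0"
      using \<phi> by (simp add: coeff_map_hom[OF A])
    then have fin: "finite {\<xi>. poly (map_poly \<phi> q) \<xi> = 0}"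
      by (intro poly_roots_finite) auto
    have "\<exists>\<psi>. hom_ext A \<phi> (adjoin A x) \<psi> \<and> \<psi> x = \<xi> \<and> \<psi> b \<noteq> 0"
      if "poly (map_poly \<phi> q) \<xi> \<noteq> 0" for \<xi>
    proof -
      have kernel: "poly (map_poly \<phi> p) \<xi> = 0" if "p \<in> polys_over A" "poly p x = 0" for p
        using transc[OF that] by simp
      obtain \<psi> where \<psi>: "hom_ext A \<phi> (adjoin A x) \<psi>"
        "\<And>p. p \<in> polys_over A \<Longrightarrow> \<psi> (poly p x) = poly (map_poly \<phi> p) \<xi>"
        using hom_adjoin[OF A \<phi>(1) kernel] by blast
      then show ?thesis
        using \<psi>(2)[OF q(1)] \<psi>(2)[OF X] q that
        by (intro exI[of _ \<psi>])
           (simp add: map_poly_pCons hom_zero[OF A \<phi>(1)] hom_one[OF A \<phi>(1)])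
    qed
    with fin show "\<exists>S. finite S \<and> (\<forall>\<xi>. \<xi> \<notin> S \<longrightarrow>
      (\<exists>\<psi>. hom_ext A \<phi> (adjoin A x) \<psi> \<and> \<psi> x = \<xi> \<and> \<psi> b \<noteq> 0))"
      by blast
  qed
qed

text \<open>Every root of the image of \<open>P\<close> may be the image of \<open>x\<close>. In
  \<open>a = lead_coeff P * c\<close>, the first factor permits cancelling the power that
  pseudo-division introduces; the second is a multiple of \<open>b\<close> lying in
  \<open>A\<close>, so that \<open>\<phi> c \<noteq> 0\<close> forces
  \<open>\<psi> b \<noteq> 0\<close>.\<close>

lemma algebraic_hom_ext:
  fixes A :: "'r::idom set"
  assumes A: "subring A" and P: "minimal_poly A x P" and b: "b \<in> adjoin A x" "b \<noteq> 0"
  shows "\<exists>a\<in>A. a \<noteq> 0 \<and> (\<forall>\<phi> :: 'r \<Rightarrow> 'k::idom. hom_on A \<phi> \<longrightarrow> \<phi> a \<noteq> 0 \<longrightarrow>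
    \<phi> (lead_coeff P) \<noteq> 0 \<and>
    (\<forall>\<xi>. poly (map_poly \<phi> P) \<xi> = 0 \<longrightarrow> (\<exists>\<psi>. hom_ext A \<phi> (adjoin A x) \<psi> \<and> \<psi> b \<noteq> 0 \<and>
      (\<forall>p\<in>polys_over A. \<psi> (poly p x) = poly (map_poly \<phi> p) \<xi>))))"
proof -
  have P': "P \<in> polys_over A" "P \<noteq> 0" "lead_coeff P \<in> A"
    using P by (auto simp: minimal_poly_def polys_over_def)
  obtain c b' where c: "c \<in> A" "b' \<in> adjoin A x" "c \<noteq> 0" "c = b * b'"
    using adjoin_algebraic_multiple[OF A P b] by blast
  show ?thesis
  proof (intro bexI[of _ "lead_coeff P * c"] conjI allI impI)
    show "lead_coeff P * c \<in> A" "lead_coeff P * c \<noteq> 0"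
      using P' c subring_mult[OF A] by auto
    fix \<phi> :: "'r \<Rightarrow> 'k" assume \<phi>: "hom_on A \<phi>" "\<phi> (lead_coeff P * c) \<noteq> 0"
    have nz: "\<phi> (lead_coeff P) \<noteq> 0" "\<phi> c \<noteq> 0"
      using \<phi> P' c hom_mult[OF A \<phi>(1)] by auto
    then show "\<phi> (lead_coeff P) \<noteq> 0" by simp
    fix \<xi> :: 'k assume \<xi>: "poly (map_poly \<phi> P) \<xi> = 0"
    have kernel: "poly (map_poly \<phi> p) \<xi> = 0" if p: "p \<in> polys_over A" "poly p x = 0" for p
    proof -
      obtain e s where s: "s \<in> polys_over A" "smult (lead_coeff P ^ e) p = s * P"
        using minimal_poly_pseudo_dvd[OF A P p] .
      have "smult (\<phi> (lead_coeff P) ^ e) (map_poly \<phi> p) = map_poly \<phi> s * map_poly \<phi> P"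
        using arg_cong[OF s(2), of "map_poly \<phi>"] s(1) P' p(1)
        by (simp add: map_poly_hom_smult[OF A \<phi>(1)] map_poly_hom_mult[OF A \<phi>(1)]
            hom_power[OF A \<phi>(1)] subring_power[OF A])
      from arg_cong[OF this, of "\<lambda>p. poly p \<xi>"] show ?thesis
        using \<xi> nz by simp
    qed
    obtain \<psi> where \<psi>: "hom_ext A \<phi> (adjoin A x) \<psi>"
      "\<And>p. p \<in> polys_over A \<Longrightarrow> \<psi> (poly p x) = poly (map_poly \<phi> p) \<xi>"
      using hom_adjoin[OF A \<phi>(1) kernel] by blast
    have "\<psi> c = \<psi> b * \<psi> b'"
      unfolding c(4) using \<psi>(1) b(1) c(2) hom_mult[OF subring_adjoin[OF A]]
      by (auto simp: hom_ext_def)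
    moreover have "\<psi> c = \<phi> c"
      using \<psi>(1) c(1) by (simp add: hom_ext_def)
    ultimately have "\<phi> c = \<psi> b * \<psi> b'"
      by simp
    then have "\<psi> b \<noteq> 0"
      using nz by auto
    then show "\<exists>\<psi>. hom_ext A \<phi> (adjoin A x) \<psi> \<and> \<psi> b \<noteq> 0 \<and>
        (\<forall>p\<in>polys_over A. \<psi> (poly p x) = poly (map_poly \<phi> p) \<xi>)"
      using \<psi> by blast
  qed
qed

lemma infinite_UNIV_alg_closed: "infinite (UNIV :: 'k::alg_closed_field set)"
proof
  assume fin: "finite (UNIV :: 'k set)"
  \<comment> \<open>Over a finite field this nonconstant polynomial takes the value 1
    everywhere.\<close>
  define p :: "'k poly" where "p = (\<Prod>a\<in>UNIV. [:- a, 1:]) + 1"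
  have "degree (\<Prod>a\<in>(UNIV :: 'k set). [:- a, 1:]) = card (UNIV :: 'k set)"
    by (subst degree_prod_eq_sum_degree) auto
  moreover have "card (UNIV :: 'k set) > 0"
    using fin by (simp add: card_gt_0_iff)
  ultimately have "degree p > 0"
    unfolding p_def by (subst degree_add_eq_left) auto
  then obtain x where "poly p x = 0"
    using alg_closed_imp_poly_has_root by blast
  moreover have "poly (\<Prod>a\<in>UNIV. [:- a, 1:]) x = 0"
    using fin by (auto simp: poly_prod)
  ultimately show False
    by (simp add: p_def)
qed

lemma degree_map_poly_hom:
  assumes "subring A" "hom_on A \<phi>" "\<phi> (lead_coeff P) \<noteq> 0"
  shows "degree (map_poly \<phi> P) = degree P"
  using assms
  by (intro antisym degree_le le_degree) (auto simp: coeff_map_hom coeff_eq_0 hom_zero)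

text \<open>In the algebraic case the image of \<open>P\<close> keeps its positive degree and has a
  root; in the transcendental case the infinite field contains a value outside the finite
  exceptional set. The condition on \<open>b\<close> allows extensions to be chained.\<close>

lemma hom_ext_adjoin:
  fixes A :: "'r::idom set"
  assumes A: "subring A" and b: "b \<in> adjoin A x" "b \<noteq> 0"
  shows "\<exists>a\<in>A. a \<noteq> 0 \<and> (\<forall>\<phi> :: 'r \<Rightarrow> 'k::alg_closed_field. hom_on A \<phi> \<longrightarrow> \<phi> a \<noteq> 0 \<longrightarrow>
    (\<exists>\<psi>. hom_ext A \<phi> (adjoin A x) \<psi> \<and> \<psi> b \<noteq> 0))"
proof (cases "\<exists>P. minimal_poly A x P")
  case True
  then obtain P where P: "minimal_poly A x P" ..
  obtain a where a: "a \<in> A" "a \<noteq> 0" "\<And>\<phi> :: 'r \<Rightarrow> 'k. hom_on A \<phi> \<Longrightarrow> \<phi> a \<noteq> 0 \<Longrightarrow>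
    \<phi> (lead_coeff P) \<noteq> 0 \<and>
    (\<forall>\<xi>. poly (map_poly \<phi> P) \<xi> = 0 \<longrightarrow> (\<exists>\<psi>. hom_ext A \<phi> (adjoin A x) \<psi> \<and> \<psi> b \<noteq> 0 \<and>
      (\<forall>p\<in>polys_over A. \<psi> (poly p x) = poly (map_poly \<phi> p) \<xi>)))"
    using algebraic_hom_ext[OF A P b] by blast
  have "\<exists>\<psi>. hom_ext A \<phi> (adjoin A x) \<psi> \<and> \<psi> b \<noteq> 0"
    if \<phi>: "hom_on A \<phi>" "\<phi> a \<noteq> 0" for \<phi> :: "'r \<Rightarrow> 'k"
  proof -
    have "degree (map_poly \<phi> P) > 0"
      using degree_map_poly_hom[OF A \<phi>(1)] a(3)[OF \<phi>] minimal_poly_degree_pos[OF A P] by simp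
    then obtain \<xi> where "poly (map_poly \<phi> P) \<xi> = 0"
      using alg_closed_imp_poly_has_root by blast
    then show ?thesis
      using a(3)[OF \<phi>] by blast
  qed
  then show ?thesis
    using a by blast
next
  case False
  then have transc: "p = 0" if "p \<in> polys_over A" "poly p x = 0" for p
    using minimal_poly_exists[OF A] that by blast
  obtain a where a: "a \<in> A" "a \<noteq> 0" "\<And>\<phi> :: 'r \<Rightarrow> 'k. hom_on A \<phi> \<Longrightarrow> \<phi> a \<noteq> 0 \<Longrightarrow>
    (\<exists>S. finite S \<and> (\<forall>\<xi>. \<xi> \<notin> S \<longrightarrow>
      (\<exists>\<psi>. hom_ext A \<phi> (adjoin A x) \<psi> \<and> \<psi> x = \<xi> \<and> \<psi> b \<noteq> 0)))"
    using transcendental_hom_ext[OF A transc b] by blast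
  then show ?thesis
    using ex_new_if_finite[OF infinite_UNIV_alg_closed[where 'k = 'k]] by meson
qed

text \<open>In the algebraic case, separability provides two roots of the image of \<open>P\<close>: a root at which
  the derivative does not vanish is simple, so it is not the only one.\<close>

lemma separating_hom_exts:
  fixes A :: "'r::idom set"
  assumes A: "subring A" and b: "b \<in> adjoin A x" "b \<noteq> 0"
    and sep: "(\<nexists>P. minimal_poly A x P) \<or>
      (\<exists>P. minimal_poly A x P \<and> degree P \<ge> 2 \<and> pderiv P \<noteq> 0)"
  shows "\<exists>a\<in>A. a \<noteq> 0 \<and> (\<forall>\<phi> :: 'r \<Rightarrow> 'k::alg_closed_field. hom_on A \<phi> \<longrightarrow> \<phi> a \<noteq> 0 \<longrightarrow>
    (\<exists>\<psi>1 \<psi>2. hom_ext A \<phi> (adjoin A x) \<psi>1 \<and> hom_ext A \<phi> (adjoin A x) \<psi>2 \<and>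
       \<psi>1 b \<noteq> 0 \<and> \<psi>2 b \<noteq> 0 \<and> \<psi>1 x \<noteq> \<psi>2 x))"
proof (cases "\<exists>P. minimal_poly A x P")
  case True
  then obtain P where P: "minimal_poly A x P" "degree P \<ge> 2" "pderiv P \<noteq> 0"
    using sep by blast
  have P': "P \<in> polys_over A" "pderiv P \<in> polys_over A" "degree P \<ge> 2" "pderiv P \<noteq> 0"
    using P polys_over_pderiv[OF A] by (auto simp: minimal_poly_def)
  have X: "[:0, 1:] \<in> polys_over A"
    by (simp add: polys_over_pCons[OF A] polys_over_zero[OF A] subring_zero[OF A] subring_one[OF A])
  \<comment> \<open>Minimality of \<open>P\<close> then excludes \<open>x\<close> as a root of its
    nonzero derivative.\<close>
  have "degree (pderiv P) < degree P"
    using P'(3) degree_le[of "degree P - 1" "pderiv P"] by (fastforce simp: coeff_pderiv coeff_eq_0)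
  then have dnz: "poly (pderiv P) x \<noteq> 0"
    using minimal_poly_less[OF A P(1) P'(2)] P'(4) by blast
  have dB: "poly (pderiv P) x \<in> adjoin A x"
    using P' by (auto simp: adjoin_def)
  \<comment> \<open>With the derivative as a factor, \<open>\<psi> c \<noteq> 0\<close> ensures both
    \<open>\<psi> b \<noteq> 0\<close> and that the chosen root of the image of \<open>P\<close> is
    simple.\<close>
  define c where "c = b * poly (pderiv P) x"
  have c: "c \<in> adjoin A x" "c \<noteq> 0"
    using b dnz subring_mult[OF subring_adjoin[OF A] b(1) dB] by (auto simp: c_def)
  obtain a where a: "a \<in> A" "a \<noteq> 0" "\<And>\<phi> :: 'r \<Rightarrow> 'k. hom_on A \<phi> \<Longrightarrow> \<phi> a \<noteq> 0 \<Longrightarrow>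
    \<phi> (lead_coeff P) \<noteq> 0 \<and>
    (\<forall>\<xi>. poly (map_poly \<phi> P) \<xi> = 0 \<longrightarrow> (\<exists>\<psi>. hom_ext A \<phi> (adjoin A x) \<psi> \<and> \<psi> c \<noteq> 0 \<and>
      (\<forall>p\<in>polys_over A. \<psi> (poly p x) = poly (map_poly \<phi> p) \<xi>)))"
    using algebraic_hom_ext[OF A P(1) c] by blast
  have "\<exists>\<psi>1 \<psi>2. hom_ext A \<phi> (adjoin A x) \<psi>1 \<and> hom_ext A \<phi> (adjoin A x) \<psi>2 \<and>
       \<psi>1 b \<noteq> 0 \<and> \<psi>2 b \<noteq> 0 \<and> \<psi>1 x \<noteq> \<psi>2 x"
    if \<phi>: "hom_on A \<phi>" "\<phi> a \<noteq> 0" for \<phi> :: "'r \<Rightarrow> 'k"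
  proof -
    let ?P = "map_poly \<phi> P"
    have deg: "degree ?P \<ge> 2"
      using degree_map_poly_hom[OF A \<phi>(1)] a(3)[OF \<phi>] P' by simp
    have ext: "\<exists>\<psi>. hom_ext A \<phi> (adjoin A x) \<psi> \<and> \<psi> b \<noteq> 0 \<and> \<psi> x = \<xi> \<and> poly (pderiv ?P) \<xi> \<noteq> 0"
      if "poly ?P \<xi> = 0" for \<xi>
    proof -
      obtain \<psi> where \<psi>: "hom_ext A \<phi> (adjoin A x) \<psi>" "\<psi> c \<noteq> 0"
        "\<And>p. p \<in> polys_over A \<Longrightarrow> \<psi> (poly p x) = poly (map_poly \<phi> p) \<xi>"
        using a(3)[OF \<phi>] \<open>poly ?P \<xi> = 0\<close> by blast
      have "\<psi> c = \<psi> b * \<psi> (poly (pderiv P) x)"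
        unfolding c_def using \<psi>(1) hom_mult[OF subring_adjoin[OF A] _ b(1) dB] by (auto simp: hom_ext_def)
      then show ?thesis
        using \<psi> \<psi>(3)[OF P'(2)] \<psi>(3)[OF X] P'
        by (intro exI[of _ \<psi>]) (auto simp: map_poly_hom_pderiv[OF A \<phi>(1)] map_poly_pCons
            hom_zero[OF A \<phi>(1)] hom_one[OF A \<phi>(1)])
    qed
    obtain \<xi> where \<xi>: "poly ?P \<xi> = 0"
      using alg_closed_imp_poly_has_root[of ?P] deg by auto
    then obtain Q where Q: "?P = [:- \<xi>, 1:] * Q"
      by (auto simp: poly_eq_0_iff_dvd elim: dvdE)
    then have "degree Q > 0"
      using deg degree_mult_le[of "[:- \<xi>, 1:]" Q] by simp
    then obtain \<eta> where \<eta>: "poly Q \<eta> = 0"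
      using alg_closed_imp_poly_has_root by blast
    \<comment> \<open>At \<open>\<xi>\<close> the product rule leaves only the value of
      \<open>Q\<close>, which is nonzero by \<open>ext\<close>. So the root \<open>\<eta>\<close> of
      \<open>Q\<close> is a second root of \<open>?P\<close>.\<close>
    have "pderiv ?P = [:- \<xi>, 1:] * pderiv Q + Q"
      unfolding Q pderiv_mult by (simp add: pderiv_pCons)
    then have "poly (pderiv ?P) \<xi> = poly Q \<xi>"
      by simp
    then have "\<xi> \<noteq> \<eta>"
      using ext[OF \<xi>] \<eta> by auto
    moreover have "poly ?P \<eta> = 0"
      using Q \<eta> by simp
    ultimately show ?thesis
      using ext[OF \<xi>] ext by metis
  qed
  then show ?thesis
    using a by blast
next
  case False
  then have transc: "p = 0" if "p \<in> polys_over A" "poly p x = 0" for p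
    using minimal_poly_exists[OF A] that by blast
  obtain a where a: "a \<in> A" "a \<noteq> 0" "\<And>\<phi> :: 'r \<Rightarrow> 'k. hom_on A \<phi> \<Longrightarrow> \<phi> a \<noteq> 0 \<Longrightarrow>
    (\<exists>S. finite S \<and> (\<forall>\<xi>. \<xi> \<notin> S \<longrightarrow>
      (\<exists>\<psi>. hom_ext A \<phi> (adjoin A x) \<psi> \<and> \<psi> x = \<xi> \<and> \<psi> b \<noteq> 0)))"
    using transcendental_hom_ext[OF A transc b] by blast
  have "\<exists>\<psi>1 \<psi>2. hom_ext A \<phi> (adjoin A x) \<psi>1 \<and> hom_ext A \<phi> (adjoin A x) \<psi>2 \<and>
       \<psi>1 b \<noteq> 0 \<and> \<psi>2 b \<noteq> 0 \<and> \<psi>1 x \<noteq> \<psi>2 x"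
    if \<phi>: "hom_on A \<phi>" "\<phi> a \<noteq> 0" for \<phi> :: "'r \<Rightarrow> 'k"
  proof -
    obtain S where S: "finite S" "\<And>\<xi>. \<xi> \<notin> S \<Longrightarrow>
      (\<exists>\<psi>. hom_ext A \<phi> (adjoin A x) \<psi> \<and> \<psi> x = \<xi> \<and> \<psi> b \<noteq> 0)"
      using a(3)[OF \<phi>] by blast
    \<comment> \<open>Any two distinct values outside the finite set \<open>S\<close> will do as
      images of \<open>x\<close>.\<close>
    obtain \<xi> where \<xi>: "\<xi> \<notin> S"
      using ex_new_if_finite[OF infinite_UNIV_alg_closed S(1)] by blast
    obtain \<eta> where \<eta>: "\<eta> \<notin> insert \<xi> S"
      using ex_new_if_finite[OF infinite_UNIV_alg_closed, of "insert \<xi> S"] S(1) by blast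
    show ?thesis
      using S(2)[OF \<xi>] S(2)[of \<eta>] \<eta> by (metis insertCI)
  qed
  then show ?thesis
    using a by blast
qed

section \<open>Extending homomorphisms to finitely generated extensions\<close>

fun adjoins :: "'r::idom set \<Rightarrow> 'r list \<Rightarrow> 'r set" where
  "adjoins A [] = A"
| "adjoins A (x # xs) = adjoins (adjoin A x) xs"

lemma subring_adjoins: "subring A \<Longrightarrow> subring (adjoins A xs)"
  by (induction xs arbitrary: A) (auto intro: subring_adjoin)

lemma subset_adjoins: "subring A \<Longrightarrow> A \<subseteq> adjoins A xs"
proof (induction xs arbitrary: A)
  case (Cons x xs)
  then show ?case
    using Cons.IH[OF subring_adjoin[of A x]] subset_adjoin[of A x] by (simp add: subset_trans)
qed simp

lemma set_subset_adjoins: "subring A \<Longrightarrow> set xs \<subseteq> adjoins A xs"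
proof (induction xs arbitrary: A)
  case (Cons x xs)
  note sub = subring_adjoin[OF Cons.prems, of x]
  have "x \<in> adjoins (adjoin A x) xs"
    by (rule subsetD[OF subset_adjoins[OF sub] generator_in_adjoin[OF Cons.prems]])
  then show ?case
    using Cons.IH[OF sub] by simp
qed simp

lemma adjoins_subset: "subring B \<Longrightarrow> A \<subseteq> B \<Longrightarrow> set xs \<subseteq> B \<Longrightarrow> adjoins A xs \<subseteq> B"
  by (induction xs arbitrary: A) (auto simp: adjoin_subset)

text \<open>The generic Nullstellensatz. The induction hypothesis over \<open>adjoin A x\<close>
  trades \<open>b\<close> for an element \<open>c\<close> of that ring, and the case of one
  generator trades \<open>c\<close> for an element of \<open>A\<close>; the extensions are then
  composed in the opposite order.\<close>

lemma hom_ext_adjoins: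
  fixes A :: "'r::idom set"
  assumes "subring A" "b \<in> adjoins A xs" "b \<noteq> 0"
  shows "\<exists>a\<in>A. a \<noteq> 0 \<and> (\<forall>\<phi> :: 'r \<Rightarrow> 'k::alg_closed_field. hom_on A \<phi> \<longrightarrow> \<phi> a \<noteq> 0 \<longrightarrow>
    (\<exists>\<psi>. hom_ext A \<phi> (adjoins A xs) \<psi> \<and> \<psi> b \<noteq> 0))"
  using assms
proof (induction xs arbitrary: A)
  case Nil
  then show ?case by (auto simp: hom_ext_def)
next
  case (Cons x xs)
  note sub = subring_adjoin[OF Cons.prems(1), of x]
  obtain c where c: "c \<in> adjoin A x" "c \<noteq> 0"
    "\<And>\<phi> :: 'r \<Rightarrow> 'k. hom_on (adjoin A x) \<phi> \<Longrightarrow> \<phi> c \<noteq> 0 \<Longrightarrow>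
      (\<exists>\<psi>. hom_ext (adjoin A x) \<phi> (adjoins (adjoin A x) xs) \<psi> \<and> \<psi> b \<noteq> 0)"
    using Cons.IH[OF sub] Cons.prems by auto
  obtain a where a: "a \<in> A" "a \<noteq> 0"
    "\<And>\<phi> :: 'r \<Rightarrow> 'k. hom_on A \<phi> \<Longrightarrow> \<phi> a \<noteq> 0 \<Longrightarrow>
      (\<exists>\<psi>. hom_ext A \<phi> (adjoin A x) \<psi> \<and> \<psi> c \<noteq> 0)"
    using hom_ext_adjoin[OF Cons.prems(1) c(1,2)] by blast
  have "\<exists>\<psi>. hom_ext A \<phi> (adjoins A (x # xs)) \<psi> \<and> \<psi> b \<noteq> 0"
    if \<phi>: "hom_on A \<phi>" "\<phi> a \<noteq> 0" for \<phi> :: "'r \<Rightarrow> 'k"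
  proof -
    obtain \<psi> where \<psi>: "hom_ext A \<phi> (adjoin A x) \<psi>" "\<psi> c \<noteq> 0"
      using a(3)[OF \<phi>] by blast
    then obtain \<chi> where "hom_ext (adjoin A x) \<psi> (adjoins (adjoin A x) xs) \<chi>" "\<chi> b \<noteq> 0"
      using c(3)[of \<psi>] by (auto simp: hom_ext_def)
    then show ?thesis
      using \<psi>(1) subset_adjoin[OF Cons.prems(1), of x]
      by (intro exI[of _ \<chi>]) (auto simp: hom_ext_def)
  qed
  then show ?case
    using a by blast
qed

section \<open>Reaching a separable polynomial by raising to powers of the characteristic\<close>

text \<open>A zero derivative means that the characteristic divides every exponent occurring in
  \<open>P\<close>. As the positive number \<open>degree P\<close> is one of these, the
  characteristic is not 0, and dividing all exponents by it yields \<open>Q\<close>.\<close>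

lemma pderiv_eq_0_imp_poly_in_power:
  fixes P :: "'r::idom poly"
  assumes A: "subring A" and P: "P \<in> polys_over A" "P \<noteq> 0" "pderiv P = 0" "degree P > 0"
  shows "CHAR('r) > 0"
    and "\<exists>Q\<in>polys_over A. Q \<noteq> 0 \<and> degree Q < degree P \<and> (\<forall>y. poly P y = poly Q (y ^ CHAR('r)))"
proof -
  define c where "c = CHAR('r)"
  have dvd: "c dvd i" if "coeff P i \<noteq> 0" for i
  proof (cases i)
    case (Suc j)
    have "coeff (pderiv P) j = 0"
      using P by simp
    then have "of_nat i = (0 :: 'r)"
      using that Suc by (simp add: coeff_pderiv del: of_nat_Suc)
    then show ?thesis
      by (simp add: c_def of_nat_eq_0_iff_char_dvd)
  qed simp
  have "c dvd degree P"
    using dvd P by simp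
  then have c: "c > 0"
    using P by (auto intro: Nat.gr0I)
  then show "CHAR('r) > 0"
    by (simp add: c_def)
  have "c \<noteq> 1"
    by (simp add: c_def)
  then have c2: "c \<ge> 2"
    using c by simp
  define d where "d = degree P div c"
  have d: "degree P = c * d"
    using \<open>c dvd degree P\<close> by (simp add: d_def)
  define Q where "Q = (\<Sum>j\<le>d. monom (coeff P (c * j)) j)"
  have coeffQ: "coeff Q j = (if j \<le> d then coeff P (c * j) else 0)" for j
    by (simp add: Q_def coeff_sum)
  have "Q \<in> polys_over A"
    using P subring_zero[OF A] by (simp add: polys_over_def coeffQ)
  moreover have "coeff Q d \<noteq> 0"
    using P(2) d by (simp add: coeffQ flip: d)
  then have "Q \<noteq> 0"
    by auto
  moreover have "degree Q \<le> d"
    by (intro degree_le) (simp add: coeffQ)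
  \<comment> \<open>Strict because \<open>c \<ge> 2\<close>, and \<open>d > 0\<close> since
    \<open>P\<close> is not constant.\<close>
  then have "degree Q < degree P"
    using d P(4) order_less_le_trans[of d "2 * d" "c * d"] mult_le_mono1[OF c2, of d] by linarith
  moreover have "poly P y = poly Q (y ^ c)" for y
  proof -
    have "poly P y = (\<Sum>i\<le>degree P. coeff P i * y ^ i)"
      by (rule poly_altdef)
    also have "\<dots> = (\<Sum>i\<in>(*) c ` {..d}. coeff P i * y ^ i)"
    proof (rule sum.mono_neutral_right)
      show "\<forall>i\<in>{..degree P} - (*) c ` {..d}. coeff P i * y ^ i = 0"
      proof
        fix i assume i: "i \<in> {..degree P} - (*) c ` {..d}"
        have "\<not> c dvd i"
          using i c d by (auto elim!: dvdE)
        then show "coeff P i * y ^ i = 0"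
          using dvd by auto
      qed
    qed (use d in auto)
    also have "\<dots> = (\<Sum>j\<le>d. coeff P (c * j) * (y ^ c) ^ j)"
      using c by (subst sum.reindex) (auto simp: inj_on_def power_mult)
    also have "\<dots> = poly Q (y ^ c)"
      by (simp add: Q_def poly_sum poly_monom)
    finally show ?thesis .
  qed
  ultimately show "\<exists>Q\<in>polys_over A. Q \<noteq> 0 \<and> degree Q < degree P \<and>
      (\<forall>y. poly P y = poly Q (y ^ CHAR('r)))"
    unfolding c_def by blast
qed

text \<open>Take a minimal polynomial of least degree among those of all admissible powers of
  \<open>x\<close>. If its derivative were zero, it would be a polynomial in the
  \<open>CHAR('r)\<close>-th power of its argument, and the next power of \<open>x\<close> would be
  a root of a polynomial of smaller degree.\<close>

lemma separable_power:
  fixes x :: "'r::idom"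
  assumes A: "subring A" and P0: "minimal_poly A x P0"
  shows "\<exists>\<nu> P. minimal_poly A (x ^ (CHAR('r) ^ \<nu>)) P \<and> pderiv P \<noteq> 0 \<and> (CHAR('r) = 0 \<longrightarrow> \<nu> = 0)"
proof -
  define S where "S = {(\<nu>, P). minimal_poly A (x ^ (CHAR('r) ^ \<nu>)) P \<and> (CHAR('r) = 0 \<longrightarrow> \<nu> = 0)}"
  have "(0, P0) \<in> S"
    using P0 by (simp add: S_def)
  then obtain \<nu> P where P: "(\<nu>, P) \<in> S" and min: "\<And>\<mu> Q. (\<mu>, Q) \<in> S \<Longrightarrow> degree P \<le> degree Q"
    using ex_has_least_nat[of "\<lambda>z. z \<in> S" "(0, P0)" "\<lambda>z. degree (snd z)"] by fastforce
  have P': "minimal_poly A (x ^ (CHAR('r) ^ \<nu>)) P"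
    using P by (simp add: S_def)
  have "pderiv P \<noteq> 0"
  proof
    assume "pderiv P = 0"
    then have prems: "P \<in> polys_over A" "P \<noteq> 0" "pderiv P = 0" "degree P > 0"
      using P' minimal_poly_degree_pos[OF A P'] by (auto simp: minimal_poly_def)
    obtain Q where Q: "Q \<in> polys_over A" "Q \<noteq> 0" "degree Q < degree P"
        "\<And>y. poly P y = poly Q (y ^ CHAR('r))"
      using pderiv_eq_0_imp_poly_in_power(2)[OF A prems] by blast
    have root: "poly Q (x ^ (CHAR('r) ^ Suc \<nu>)) = 0"
      using Q(4)[of "x ^ (CHAR('r) ^ \<nu>)"] P'
      by (simp add: minimal_poly_def mult.commute flip: power_mult)
    obtain R where R: "minimal_poly A (x ^ (CHAR('r) ^ Suc \<nu>)) R"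
      using minimal_poly_exists[OF A Q(1,2) root] ..
    have "(Suc \<nu>, R) \<in> S"
      using R pderiv_eq_0_imp_poly_in_power(1)[OF A prems] by (simp add: S_def)
    from min[OF this] R Q root show False
      unfolding minimal_poly_def by fastforce
  qed
  moreover have "CHAR('r) = 0 \<longrightarrow> \<nu> = 0"
    using P by (simp add: S_def)
  ultimately show ?thesis
    using P' by (intro exI conjI)
qed


section \<open>Homomorphisms from polynomial rings as evaluations\<close>

definition mpoly_var :: "nat \<Rightarrow> 'k::comm_semiring_1 mpoly" where
  "mpoly_var i = Poly_Mapping.single (Poly_Mapping.single i 1) 1"

lemma sum_single_lookup:
  "(\<Sum>k\<in>Poly_Mapping.keys p. Poly_Mapping.single k (Poly_Mapping.lookup p k)) = p"
  by (rule poly_mapping_eqI) (auto simp: lookup_sum lookup_single when_def in_keys_iff)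

lemma prod_mpoly_var_power:
  "(\<Prod>i\<in>I. mpoly_var i ^ e i) =
     Poly_Mapping.single (\<Sum>i\<in>I. Poly_Mapping.single i (e i)) (1 :: 'k::comm_semiring_1)"
proof -
  have "mpoly_var i ^ k = Poly_Mapping.single (Poly_Mapping.single i k) (1 :: 'k)" for i k
    by (induction k) (simp_all add: mpoly_var_def mult_single flip: single_add)
  then show ?thesis
    by (induction I rule: infinite_finite_induct) (simp_all add: mult_single)
qed

lemma mpoly_subst_var: "mpoly_subst mpoly_const p mpoly_var = (p :: 'k::comm_semiring_1 mpoly)"
  by (simp add: mpoly_subst_def prod_mpoly_var_power sum_single_lookup mpoly_const_def mult_single)

text \<open>Writing \<open>p\<close> as its own value at the variables expands it into constants
  times monomials, and \<open>\<psi>\<close> passes through these sums and products. The restriction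
  to \<open>{..<n}\<close> fits the encoding of points and changes nothing, as only variables below
  \<open>n\<close> occur in \<open>p\<close>.\<close>

lemma hom_eq_mpoly_eval:
  fixes \<psi> :: "'k::idom mpoly \<Rightarrow> 'k"
  assumes B: "subring B" and hom: "hom_on B \<psi>"
    and const: "range mpoly_const \<subseteq> B" "\<And>c. \<psi> (mpoly_const c) = c"
    and var: "mpoly_var ` {..<n} \<subseteq> B" and p: "p \<in> mpoly_ring n"
  shows "p \<in> B" and "\<psi> p = mpoly_eval p (\<lambda>i\<in>{..<n}. \<psi> (mpoly_var i))"
proof -
  have keys: "i < n" if "\<mu> \<in> Poly_Mapping.keys p" "i \<in> Poly_Mapping.keys \<mu>" for \<mu> i
    using p that by (auto simp: mpoly_ring_def mpoly_vars_def)
  have pow: "mpoly_var i ^ k \<in> B" if "i < n" for i k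
    using var that by (intro subring_power[OF B]) auto
  have prod: "(\<Prod>i\<in>Poly_Mapping.keys \<mu>. mpoly_var i ^ Poly_Mapping.lookup \<mu> i) \<in> B"
    if "\<mu> \<in> Poly_Mapping.keys p" for \<mu>
    using that by (intro subring_prod[OF B] pow keys)
  have "mpoly_subst mpoly_const p mpoly_var \<in> B"
    unfolding mpoly_subst_def using const(1)
    by (intro subring_sum[OF B] subring_mult[OF B] prod) auto
  then show "p \<in> B"
    by (simp add: mpoly_subst_var)
  have "\<psi> p = \<psi> (mpoly_subst mpoly_const p mpoly_var)"
    by (simp add: mpoly_subst_var)
  also have "\<dots> = (\<Sum>\<mu>\<in>Poly_Mapping.keys p. \<psi> (mpoly_const (Poly_Mapping.lookup p \<mu>) *
      (\<Prod>i\<in>Poly_Mapping.keys \<mu>. mpoly_var i ^ Poly_Mapping.lookup \<mu> i)))"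
    unfolding mpoly_subst_def using const(1)
    by (intro hom_sum[OF B hom] subring_mult[OF B] prod) auto
  also have "\<dots> = mpoly_eval p (\<lambda>i\<in>{..<n}. \<psi> (mpoly_var i))"
    unfolding mpoly_eval_def mpoly_subst_def
  proof (rule sum.cong[OF refl])
    fix \<mu> assume \<mu>: "\<mu> \<in> Poly_Mapping.keys p"
    have "\<psi> (\<Prod>i\<in>Poly_Mapping.keys \<mu>. mpoly_var i ^ Poly_Mapping.lookup \<mu> i) =
        (\<Prod>i\<in>Poly_Mapping.keys \<mu>. \<psi> (mpoly_var i ^ Poly_Mapping.lookup \<mu> i))"
      using \<mu> by (intro hom_prod[OF B hom] pow keys)
    also have "\<dots> = (\<Prod>i\<in>Poly_Mapping.keys \<mu>.
        (\<lambda>i\<in>{..<n}. \<psi> (mpoly_var i)) i ^ Poly_Mapping.lookup \<mu> i)"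
      using keys[OF \<mu>] var by (intro prod.cong refl) (simp add: hom_power[OF B hom] image_subset_iff)
    finally show "\<psi> (mpoly_const (Poly_Mapping.lookup p \<mu>) *
        (\<Prod>i\<in>Poly_Mapping.keys \<mu>. mpoly_var i ^ Poly_Mapping.lookup \<mu> i)) =
      Poly_Mapping.lookup p \<mu> * (\<Prod>i\<in>Poly_Mapping.keys \<mu>.
        (\<lambda>i\<in>{..<n}. \<psi> (mpoly_var i)) i ^ Poly_Mapping.lookup \<mu> i)"
      using hom_mult[OF B hom _ prod[OF \<mu>]] const by (simp add: range_subsetD)
  qed
  finally show "\<psi> p = mpoly_eval p (\<lambda>i\<in>{..<n}. \<psi> (mpoly_var i))" .
qed

lemma subring_range_mpoly_const: "subring (range (mpoly_const :: 'k::idom \<Rightarrow> _))"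
  unfolding subring_def
proof (intro conjI ballI)
  have "mpoly_const 1 = (1 :: 'k mpoly)"
    by (simp add: mpoly_const_def)
  then show "1 \<in> range (mpoly_const :: 'k \<Rightarrow> _)"
    by (metis rangeI)
  fix x y :: "'k mpoly" assume "x \<in> range mpoly_const" "y \<in> range mpoly_const"
  then obtain a b where "x = mpoly_const a" "y = mpoly_const b"
    by auto
  then have "x - y = mpoly_const (a - b)" "x * y = mpoly_const (a * b)"
    by (simp_all add: mpoly_const_def single_diff mult_single)
  then show "x - y \<in> range mpoly_const" "x * y \<in> range mpoly_const"
    by simp_all
qed

text \<open>The constant coefficient inverts \<open>mpoly_const\<close>; this is the homomorphism
  from which all extensions start.\<close>

lemma hom_on_lookup_0: "hom_on (range mpoly_const) (\<lambda>p :: 'k::idom mpoly. Poly_Mapping.lookup p 0)"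
  by (auto simp: hom_on_def mpoly_const_def mult_single lookup_add lookup_one)

lemma CHAR_mpoly: "CHAR('k::idom mpoly) = CHAR('k)"
proof (rule CHAR_eqI)
  have *: "of_nat n = (0 :: 'k mpoly) \<longleftrightarrow> of_nat n = (0 :: 'k)" for n
  proof -
    have "(of_nat n :: 'k mpoly) = Poly_Mapping.single 0 (of_nat n)"
      by simp
    moreover have "Poly_Mapping.single 0 c = (0 :: 'k mpoly) \<longleftrightarrow> c = 0" for c
      by (metis lookup_single_eq lookup_zero single_zero)
    ultimately show ?thesis
      by (simp only:)
  qed
  show "of_nat CHAR('k) = (0 :: 'k mpoly)"
    by (simp add: *)
  show "CHAR('k) dvd n" if "of_nat n = (0 :: 'k mpoly)" for n
    using that by (simp add: * of_nat_eq_0_iff_char_dvd)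
qed

lemma subring_to_fract_vimage:
  assumes "is_subfield F"
  shows "subring {p. to_fract p \<in> F}"
proof -
  have "x - y \<in> F" if "x \<in> F" "y \<in> F" for x y
    using assms that unfolding is_subfield_def by (metis add_uminus_conv_diff)
  then show ?thesis
    using assms by (simp add: subring_def is_subfield_def)
qed

section \<open>Separating two points of a common fibre\<close>

text \<open>This treats both characteristics at once: for \<open>\<nu> = 0\<close> the power is
  \<open>g\<close> itself.\<close>

lemma determined_power_in_rat_gen:
  fixes f :: "nat \<Rightarrow> 'k::alg_closed_field mpoly"
  assumes f: "\<forall>i<m. f i \<in> mpoly_ring n" and g: "g \<in> determined_algebra n m f"
  shows "\<exists>\<nu>. (CHAR('k) = 0 \<longrightarrow> \<nu> = 0) \<and> to_fract (g ^ (CHAR('k) ^ \<nu>)) \<in> rat_gen n m f"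
proof -
  define C where "C = range (mpoly_const :: 'k \<Rightarrow> _)"
  define A where "A = adjoins C (map f [0..<m])"
  have C: "subring C"
    unfolding C_def by (rule subring_range_mpoly_const)
  have A: "subring A"
    unfolding A_def by (rule subring_adjoins[OF C])
  have CA: "C \<subseteq> A"
    unfolding A_def by (rule subset_adjoins[OF C])
  have fA: "f i \<in> A" if "i < m" for i
    using set_subset_adjoins[OF C, of "map f [0..<m]"] that by (auto simp: A_def)
  have F: "is_subfield (rat_gen n m f)"
    using f by (rule is_subfield_rat_gen)
  have "to_fract ` (range mpoly_const \<union> f ` {..<m}) \<subseteq> rat_gen n m f"
    unfolding rat_gen_def by (rule hull_subset)
  then have "A \<subseteq> {p. to_fract p \<in> rat_gen n m f}"
    unfolding A_def C_def by (intro adjoins_subset subring_to_fract_vimage F) auto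
  then have AF: "to_fract p \<in> rat_gen n m f" if "p \<in> A" for p
    using that by auto
  have "\<exists>\<nu>. (CHAR('k) = 0 \<longrightarrow> \<nu> = 0) \<and> ((\<nexists>P. minimal_poly A (g ^ (CHAR('k) ^ \<nu>)) P) \<or>
      (\<exists>P. minimal_poly A (g ^ (CHAR('k) ^ \<nu>)) P \<and> pderiv P \<noteq> 0))"
  proof (cases "\<exists>P. minimal_poly A g P")
    case True
    then obtain P0 where P0: "minimal_poly A g P0" ..
    obtain \<nu> P where "minimal_poly A (g ^ (CHAR('k) ^ \<nu>)) P" "pderiv P \<noteq> 0"
        "CHAR('k) = 0 \<longrightarrow> \<nu> = 0"
      using separable_power[OF A P0, unfolded CHAR_mpoly] by (elim exE conjE)
    then show ?thesis
      by (intro exI[of _ \<nu>] conjI disjI2 exI[of _ P])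
  next
    case False
    then show ?thesis
      by (intro exI[of _ 0]) simp
  qed
  then obtain \<nu> where \<nu>: "CHAR('k) = 0 \<longrightarrow> \<nu> = 0"
      "(\<nexists>P. minimal_poly A (g ^ (CHAR('k) ^ \<nu>)) P) \<or>
       (\<exists>P. minimal_poly A (g ^ (CHAR('k) ^ \<nu>)) P \<and> pderiv P \<noteq> 0)"
    by (elim exE conjE)
  define N where "N = CHAR('k) ^ \<nu>"
  define h where "h = g ^ N"
  have "to_fract h \<in> rat_gen n m f"
  proof (rule ccontr)
    assume nonrat: "to_fract h \<notin> rat_gen n m f"
    \<comment> \<open>A relation \<open>u + h * v = 0\<close> of degree 1 would exhibit
      \<open>h\<close> as the quotient \<open>- u / v\<close> in the field generated by
      \<open>f\<close>.\<close>
    have "degree P \<ge> 2" if P: "minimal_poly A h P" for P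
    proof (rule ccontr)
      assume "\<not> degree P \<ge> 2"
      then have "degree P = 1"
        using minimal_poly_degree_pos[OF A P] by simp
      define u v where "u = coeff P 0" and "v = coeff P 1"
      have "u \<in> A" "v \<in> A" "v \<noteq> 0"
        using P \<open>degree P = 1\<close> leading_coeff_neq_0[of P]
        by (auto simp: minimal_poly_def polys_over_def u_def v_def)
      have "u + h * v = 0"
        using P \<open>degree P = 1\<close> by (simp add: minimal_poly_def poly_altdef u_def v_def mult.commute)
      then have "to_fract h * to_fract v = - to_fract u"
        by (simp add: eq_neg_iff_add_eq_0 add.commute flip: to_fract_mult to_fract_add)
      then have "to_fract h = - to_fract u * inverse (to_fract v)"
        using \<open>v \<noteq> 0\<close> by (simp add: field_simps)
      moreover have "- to_fract u * inverse (to_fract v) \<in> rat_gen n m f"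
        using F AF[OF \<open>u \<in> A\<close>] AF[OF \<open>v \<in> A\<close>] by (simp add: is_subfield_def)
      ultimately show False
        using nonrat by simp
    qed
    then have sep: "(\<nexists>P. minimal_poly A h P) \<or>
        (\<exists>P. minimal_poly A h P \<and> degree P \<ge> 2 \<and> pderiv P \<noteq> 0)"
      using \<nu>(2) unfolding h_def N_def by blast
    note Ah = subring_adjoin[OF A, of h]
    \<comment> \<open>\<open>B\<close> contains the constants and the variables, so homomorphisms on
      it that fix the constants are evaluations on \<open>mpoly_ring n\<close>.\<close>
    define B where "B = adjoins (adjoin A h) (map mpoly_var [0..<n])"
    have B: "subring B"
      unfolding B_def by (rule subring_adjoins[OF Ah])
    have AhB: "adjoin A h \<subseteq> B"
      unfolding B_def by (rule subset_adjoins[OF Ah])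
    have varB: "mpoly_var ` {..<n} \<subseteq> B"
      using set_subset_adjoins[OF Ah, of "map mpoly_var [0..<n]"]
      by (auto simp: B_def)
    \<comment> \<open>The conditions of nonvanishing descend from \<open>B\<close> through
      \<open>adjoin A h\<close> and \<open>A\<close> to \<open>C\<close>. At the top the element 1
      suffices, as only the existence of an extension is wanted there.\<close>
    obtain b where b: "b \<in> adjoin A h" "b \<noteq> 0"
      "\<And>\<phi> :: _ \<Rightarrow> 'k. hom_on (adjoin A h) \<phi> \<Longrightarrow> \<phi> b \<noteq> 0 \<Longrightarrow> \<exists>\<psi>. hom_ext (adjoin A h) \<phi> B \<psi>"
      using hom_ext_adjoins[OF Ah subring_one[OF B, unfolded B_def] one_neq_zero, where 'k = 'k]
      unfolding B_def by blast
    obtain a where a: "a \<in> A" "a \<noteq> 0"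
      "\<And>\<phi> :: _ \<Rightarrow> 'k. hom_on A \<phi> \<Longrightarrow> \<phi> a \<noteq> 0 \<Longrightarrow>
        \<exists>\<psi>1 \<psi>2. hom_ext A \<phi> (adjoin A h) \<psi>1 \<and> hom_ext A \<phi> (adjoin A h) \<psi>2 \<and>
          \<psi>1 b \<noteq> 0 \<and> \<psi>2 b \<noteq> 0 \<and> \<psi>1 h \<noteq> \<psi>2 h"
      using separating_hom_exts[OF A b(1,2) sep, where 'k = 'k] by blast
    obtain c where c: "c \<in> C" "c \<noteq> 0"
      "\<And>\<phi> :: _ \<Rightarrow> 'k. hom_on C \<phi> \<Longrightarrow> \<phi> c \<noteq> 0 \<Longrightarrow> \<exists>\<psi>. hom_ext C \<phi> A \<psi> \<and> \<psi> a \<noteq> 0"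
      using hom_ext_adjoins[OF C a(1)[unfolded A_def] a(2), where 'k = 'k]
      unfolding A_def by blast
    \<comment> \<open>From here the homomorphisms are built upwards. On the constants the condition
      holds outright, because \<open>c\<close> is a nonzero constant.\<close>
    define \<phi> :: "'k mpoly \<Rightarrow> 'k" where "\<phi> p = Poly_Mapping.lookup p 0" for p
    have "hom_on C \<phi>" "\<phi> c \<noteq> 0"
      using hom_on_lookup_0 c(1,2) by (auto simp: C_def \<phi>_def[abs_def] mpoly_const_def)
    then obtain \<phi>A where \<phi>A: "hom_ext C \<phi> A \<phi>A" "\<phi>A a \<noteq> 0"
      using c(3) by blast
    then obtain \<psi>1 \<psi>2 where \<psi>: "hom_ext A \<phi>A (adjoin A h) \<psi>1" "hom_ext A \<phi>A (adjoin A h) \<psi>2"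
        "\<psi>1 b \<noteq> 0" "\<psi>2 b \<noteq> 0" "\<psi>1 h \<noteq> \<psi>2 h"
      using a(3)[of \<phi>A] by (auto simp: hom_ext_def)
    \<comment> \<open>Extending \<open>\<psi>\<close> to \<open>B\<close> yields a point
      \<open>z\<close>. Its values under \<open>f\<close> come from \<open>\<phi>A\<close> alone and
      so do not depend on \<open>\<psi>\<close>, whereas the \<open>N\<close>-th power of the value
      of \<open>g\<close> is \<open>\<psi> h\<close>.\<close>
    have point: "\<exists>z \<in> {..<n} \<rightarrow>\<^sub>E UNIV. (\<forall>i<m. mpoly_eval (f i) z = \<phi>A (f i)) \<and>
        mpoly_eval g z ^ N = \<psi> h"
      if \<psi>: "hom_ext A \<phi>A (adjoin A h) \<psi>" "\<psi> b \<noteq> 0" for \<psi>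
    proof -
      obtain \<chi> where \<chi>: "hom_ext (adjoin A h) \<psi> B \<chi>"
        using b(3)[of \<psi>] \<psi> by (auto simp: hom_ext_def)
      then have hom: "hom_on B \<chi>"
        by (simp add: hom_ext_def)
      have \<chi>A: "\<chi> p = \<phi>A p" if "p \<in> A" for p
        using \<chi> \<psi>(1) subset_adjoin[OF A, of h] that by (auto simp: hom_ext_def)
      have constB: "range mpoly_const \<subseteq> B"
        using CA subset_adjoin[OF A, of h] AhB by (auto simp: C_def)
      have const: "\<chi> (mpoly_const c) = c" for c
        using \<chi>A[of "mpoly_const c"] \<phi>A(1) CA
        by (auto simp: hom_ext_def C_def \<phi>_def mpoly_const_def)
      define z where "z = (\<lambda>i\<in>{..<n}. \<chi> (mpoly_var i))"
      note eval = hom_eq_mpoly_eval[OF B hom constB const varB, folded z_def]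
      have gn: "g \<in> mpoly_ring n"
        using g by (simp add: determined_algebra_def)
      have "mpoly_eval g z ^ N = \<chi> h"
        using eval[OF gn] by (simp add: h_def hom_power[OF B hom])
      also have "\<dots> = \<psi> h"
        using \<chi> generator_in_adjoin[OF A] by (simp add: hom_ext_def)
      finally have "mpoly_eval g z ^ N = \<psi> h" .
      moreover have "mpoly_eval (f i) z = \<phi>A (f i)" if "i < m" for i
        using eval(2)[of "f i"] f \<chi>A[OF fA[OF that]] that by simp
      moreover have "z \<in> {..<n} \<rightarrow>\<^sub>E UNIV"
        by (simp add: z_def)
      ultimately show ?thesis
        by blast
    qed
    obtain y where y: "y \<in> {..<n} \<rightarrow>\<^sub>E UNIV" "\<forall>i<m. mpoly_eval (f i) y = \<phi>A (f i)"
        "mpoly_eval g y ^ N = \<psi>1 h"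
      using point[OF \<psi>(1,3)] by blast
    obtain z where z: "z \<in> {..<n} \<rightarrow>\<^sub>E UNIV" "\<forall>i<m. mpoly_eval (f i) z = \<phi>A (f i)"
        "mpoly_eval g z ^ N = \<psi>2 h"
      using point[OF \<psi>(2,4)] by blast
    have "determined_by n m f g"
      using g by (simp add: determined_algebra_def)
    moreover have "\<forall>i<m. mpoly_eval (f i) y = mpoly_eval (f i) z"
      using y(2) z(2) by simp
    ultimately have "mpoly_eval g y = mpoly_eval g z"
      using y(1) z(1) unfolding determined_by_def by blast
    \<comment> \<open>Equal values of \<open>g\<close> have equal \<open>N\<close>-th powers, but
      these are \<open>\<psi>1 h\<close> and \<open>\<psi>2 h\<close>.\<close>
    with y(3) z(3) \<psi>(5) show False
      by simp
  qed
  then show ?thesis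
    using \<nu>(1) unfolding h_def N_def by (intro exI[of _ \<nu>] conjI)
qed

theorem theorem3p3:
  fixes f :: "nat \<Rightarrow> 'k::alg_closed_field mpoly" and m n :: nat
  assumes "m \<ge> 1" and "n \<ge> 1"
    and "\<forall>i<m. f i \<in> mpoly_ring n"
    and "alg_independent m f"
  shows "(CHAR('k) = 0 \<longrightarrow> determined_algebra n m f \<subseteq> rat_gen_polys n m f) \<and>
         (CHAR('k) > 0 \<longrightarrow> determined_algebra n m f \<subseteq> rad_char n (rat_gen_polys n m f))"
proof -
  have ring: "g \<in> mpoly_ring n" if "g \<in> determined_algebra n m f" for g
    using that by (simp add: determined_algebra_def)
  have power: "g ^ k \<in> mpoly_ring n" if "g \<in> mpoly_ring n" for g :: "'k mpoly" and k
    using that by (induction k) (auto intro: mpoly_ring_closed)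
  show ?thesis
    using determined_power_in_rat_gen[OF assms(3)] ring power
    by (fastforce simp: rat_gen_polys_def rad_char_def)
qed

end
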